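(* Let $\mathcal{H}_1,\mathcal{H}_2$ be real or complex Hilbert spaces, $M\subseteq\mathcal{H}_1$ and $N\subseteq\mathcal{H}_2$ closed subspaces, and let $T\in\mathcal{B}(\mathcal{H}_1,\mathcal{H}_2)$ have block form $T=\begin{pmatrix}A&B\\C&D\end{pmatrix}$ with respect to $\mathcal{H}_1=M\oplus M^\perp$ and $\mathcal{H}_2=N\oplus N^\perp$. Assume that $T$ is $(M,N)$-complementable and let $X\in\mathcal{B}(M,M^\perp)$ be an operator satisfying $C=DX$. Let $S:M\to N$ denote the Schur complement $T_{/(M,N)}$ regarded as an operator from $M$ to $N$. Then: (1) The following are equivalent: (a) $\|T^*x\|\ge\|(T_{/(M,N)})^*x\|$ for every $x\in N$; (b) $BB^*+AX^*B^*+BXA^*-BXX^*B^*\ge 0$; (c) $BB^*+AA^*\ge SS^*$. (2) The following are equivalent: (a) $\|T^*x\|\le\|(T_{/(M,N)})^*x\|$ for every $x\in N$; (b) $BB^*+AX^*B^*+BXA^*-BXX^*B^*\le 0$; (c) $BB^*+AA^*\le SS^*$. (3) The following are equivalent: (a) $\|T^*x\|=\|(T_{/(M,N)})^*x\|$ for every $x\in N$; (b) $BB^*+AX^*B^*+BXA^*-BXX^*B^*=0$; (c) $BB^*+AA^*=SS^*$.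
   Context: $\mathcal{B}(\mathcal{H},\mathcal{K})$ is the space of bounded linear operators; $\mathcal{R}(\cdot)$ and $\mathcal{N}(\cdot)$ denote range and null space. Block entries: $A:M\to N$, $B:M^\perp\to N$, $C:M\to N^\perp$, $D:M^\perp\to N^\perp$, all bounded. $T$ is $(M,N)$-complementable if $\mathcal{R}(C)\subseteq\mathcal{R}(D)$ and $\mathcal{R}(B^* )\subseteq\mathcal{R}(D^* )$. If $\mathcal{R}(A_1)\subseteq\mathcal{R}(B_1)$ for bounded operators $A_1,B_1$ with the same codomain, the Douglas reduced solution of $A_1=B_1X$ is the unique bounded $C_1$ with $A_1=B_1C_1$ and $\mathcal{R}(C_1)\subseteq\mathcal{N}(B_1)^\perp$. For $(M,N)$-complementable $T$, the Schur complement is $T_{/(M,N)}=\begin{pmatrix}A-BZ&0\\0&0\end{pmatrix}=\begin{pmatrix}A-YC&0\\0&0\end{pmatrix}$, where $Z$ is the Douglas reduced solution of $C=DX$ and $Y^*$ is the Douglas reduced solution of $B^*=D^*X$. For self-adjoint operators on $N$, $P\ge Q$ means $\langle (P-Q)x,x\rangle\ge 0$ for all $x\in N$. A vector $x\in N$ is identified with $(x,0)\in N\oplus N^\perp$. *)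

theory Defs
  imports "HOL-Analysis.Analysis"
begin

section \<open>Real or complex scalars\<close>

text \<open>
  A common abstraction of the scalar fields of real and of complex numbers. The axiom
  \<open>mult_cj_scaleR\<close> determines \<open>cj\<close>, and lemma \<open>real_or_complex_cases\<close> below
  shows that there is no other field in the class, up to isomorphism.
\<close>

class real_or_complex = real_normed_field +
  fixes cj :: "'a \<Rightarrow> 'a"
  assumes cj_add: "cj (x + y) = cj x + cj y"
    and mult_cj_scaleR: "x * cj x = (norm x)\<^sup>2 *\<^sub>R 1"

instantiation real :: real_or_complex
begin
definition cj_real :: "real \<Rightarrow> real" where "cj_real x = x"
instance by standard (auto simp: cj_real_def power2_eq_square)
end

instantiation complex :: real_or_complex
begin
definition cj_complex :: "complex \<Rightarrow> complex" where "cj_complex = cnj"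
instance by standard (auto simp: cj_complex_def complex_norm_square [symmetric] scaleR_conv_of_real)
end

lemma mult_cj: "x * cj x = of_real ((norm x)\<^sup>2)" for x :: "'k::real_or_complex"
  by (simp add: mult_cj_scaleR of_real_def)

lemma cj_0 [simp]: "cj (0::'k::real_or_complex) = 0"
  using cj_add[of "0::'k" 0] by simp

lemma cj_minus: "cj (- x) = - cj (x::'k::real_or_complex)"
  using cj_add[of x "-x"] by (simp add: eq_neg_iff_add_eq_0 add.commute)

lemma cj_of_real [simp]: "cj (of_real r) = (of_real r :: 'k::real_or_complex)"
proof (cases "r = 0")
  case False
  have "of_real r * cj (of_real r :: 'k) = of_real r * of_real r"
    using mult_cj[of "of_real r :: 'k"] by (simp add: power2_eq_square flip: of_real_mult)
  with False show ?thesis by simp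
qed simp

lemma cj_mult: "cj (x * y) = cj x * cj (y::'k::real_or_complex)"
proof (cases "x * y = 0")
  case False
  have "(x * y) * cj (x * y) = (x * cj x) * (y * cj y)"
    by (simp add: mult_cj norm_mult power_mult_distrib)
  also have "\<dots> = (x * y) * (cj x * cj y)" by (simp add: ac_simps)
  finally show ?thesis using False by simp
qed auto

lemma add_cj_Reals: "x + cj x \<in> \<real>" for x :: "'k::real_or_complex"
proof -
  have cj_1: "cj (1::'k) = 1"
    using cj_of_real[of 1, where 'k = 'k] by simp
  have "(1 + x) * cj (1 + x) = 1 + x + cj x + x * cj x"
    unfolding cj_add cj_1 by (simp add: distrib_left distrib_right)
  then have "x + cj x = of_real ((norm (1 + x))\<^sup>2) - 1 - of_real ((norm x)\<^sup>2)"
    unfolding mult_cj by (simp del: of_real_power)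
  also have "\<dots> = of_real ((norm (1 + x))\<^sup>2 - 1 - (norm x)\<^sup>2)" by simp
  finally have "x + cj x = of_real ((norm (1 + x))\<^sup>2 - 1 - (norm x)\<^sup>2)" .
  then show ?thesis by (simp only: Reals_of_real)
qed

lemma cj_cj [simp]: "cj (cj x) = (x::'k::real_or_complex)"
proof -
  obtain r where r: "x + cj x = of_real r" using add_cj_Reals[of x] by (auto elim: Reals_cases)
  then have "cj x + cj (cj x) = of_real r" by (simp only: cj_of_real flip: cj_add)
  also have "\<dots> = cj x + x" using r by (simp only: add.commute)
  finally show ?thesis by (rule add_left_imp_eq)
qed

lemma cj_eq_imp_Reals: "cj x = x \<Longrightarrow> x \<in> \<real>" for x :: "'k::real_or_complex"
proof -
  assume "cj x = x"
  then have "(x + x) / 2 \<in> \<real>" using add_cj_Reals[of x] by (intro Reals_divide) auto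
  then show ?thesis by simp
qed

lemma real_or_complex_cases:
  "(UNIV :: 'k set) = \<real> \<or>
   (\<exists>i::'k::real_or_complex. i * i = -1 \<and> (\<forall>x. \<exists>a b. x = of_real a + of_real b * i))"
proof (cases "\<forall>x::'k. cj x = x")
  case True
  then show ?thesis using cj_eq_imp_Reals by blast
next
  case False
  then obtain w :: 'k where w: "cj w \<noteq> w" by blast
  define y where "y = w - cj w"
  have y0: "y \<noteq> 0" using w by (auto simp: y_def)
  have cy: "cj y = - y" using cj_add[of w "- cj w"] by (simp add: y_def cj_minus)
  define i where "i = y / of_real (norm y)"
  have yy: "y * y = - of_real ((norm y)\<^sup>2)" using mult_cj[of y] by (simp add: cy) (metis minus_minus)
  have ii: "i * i = -1" using y0 by (simp add: i_def yy power2_eq_square)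
  have "i * of_real (norm y) = y" using y0 by (simp add: i_def)
  then have "cj i * of_real (norm y) = - i * of_real (norm y)"
    using cj_mult[of i "of_real (norm y)"] cy by simp
  then have "cj i * of_real (norm y) = (- i) * of_real (norm y)" by simp
  then have ci: "cj i = - i" using y0 by (subst (asm) mult_cancel_right) auto
  have "\<exists>a b. x = of_real a + of_real b * i" for x
  proof -
    obtain r where r: "x + cj x = of_real r" using add_cj_Reals[of x] by (auto elim: Reals_cases)
    have "cj (x - cj x) = cj x - x"
      using cj_add[of x "- cj x"] by (simp add: cj_minus)
    then have "cj ((x - cj x) * i) = (x - cj x) * i"
      by (simp only: cj_mult ci) (simp add: algebra_simps)
    then obtain s where s: "(x - cj x) * i = of_real s"
      using cj_eq_imp_Reals by (auto elim: Reals_cases)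
    have "x - cj x = - ((x - cj x) * i) * i"
      using ii by (simp add: mult.assoc)
    also have "\<dots> = of_real (- s) * i" unfolding s by simp
    finally have "x - cj x = of_real (- s) * i" .
    moreover have "2 * x = (x + cj x) + (x - cj x)" by simp
    ultimately have eq: "2 * x = of_real r + of_real (- s) * i" unfolding r by simp
    have "x = 2 * x / 2" by simp
    also have "\<dots> = (of_real r + of_real (- s) * i) / 2" by (simp only: eq)
    also have "\<dots> = of_real (r / 2) + of_real (- s / 2) * i"
      by (simp add: diff_divide_distrib)
    finally have "x = of_real (r / 2) + of_real (- s / 2) * i" .
    then show ?thesis by blast
  qed
  with ii show ?thesis by blast
qed


section \<open>Hilbert spaces\<close>

text \<open>
  The class \<open>banach\<close> supplies the topology and completeness; the two last assumptions say
  that its norm is the one induced by the inner product \<open>ip\<close> and that its real scalar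
  multiplication is the restriction of \<open>scale\<close>.
\<close>

locale hilbert_space = vector_space scale
  for scale :: "'k::real_or_complex \<Rightarrow> 'a::banach \<Rightarrow> 'a" +
  fixes ip :: "'a \<Rightarrow> 'a \<Rightarrow> 'k"
  assumes ip_add_left: "ip (x + y) z = ip x z + ip y z"
    and ip_scale_left: "ip (scale c x) y = c * ip x y"
    and ip_cj: "cj (ip x y) = ip y x"
    and ip_self: "ip x x = of_real ((norm x)\<^sup>2)"
    and scale_of_real: "scale (of_real r) x = r *\<^sub>R x"

lemma hilbert_space_inner:
  "hilbert_space (\<lambda>r x. r *\<^sub>R x) (\<lambda>x y. x \<bullet> (y::'a::{real_inner, banach}))"
  by unfold_locales
    (auto simp: algebra_simps inner_add_left inner_commute cj_real_def power2_norm_eq_inner)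

lemma hilbert_space_complex: "hilbert_space (*) (\<lambda>x y. x * cnj y)"
  by unfold_locales
    (auto simp: algebra_simps cj_complex_def complex_norm_square [symmetric] scaleR_conv_of_real)

definition orth :: "('a \<Rightarrow> 'a \<Rightarrow> 'k::zero) \<Rightarrow> 'a set \<Rightarrow> 'a set"
  where "orth ip M = {y. \<forall>x\<in>M. ip x y = 0}"

definition proj :: "('a::minus \<Rightarrow> 'a \<Rightarrow> 'k::zero) \<Rightarrow> 'a set \<Rightarrow> 'a \<Rightarrow> 'a"
  where "proj ip M x = (THE y. y \<in> M \<and> x - y \<in> orth ip M)"


section \<open>Bounded operators between closed subspaces\<close>

text \<open>
  An operator from a subspace \<open>E\<close> to a subspace \<open>F\<close> is an extensional function
  in the sense of \<open>HOL-Library.FuncSet\<close>, so equality of operators is equality of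
  functions. For \<open>E = F = UNIV\<close> these are the operators on the whole spaces.
\<close>

definition bounded_ops ::
  "('k \<Rightarrow> 'a::real_normed_vector \<Rightarrow> 'a) \<Rightarrow> 'a set \<Rightarrow>
   ('k \<Rightarrow> 'b::real_normed_vector \<Rightarrow> 'b) \<Rightarrow> 'b set \<Rightarrow> ('a \<Rightarrow> 'b) set"
  where "bounded_ops s1 E s2 F = {f \<in> E \<rightarrow>\<^sub>E F.
    (\<forall>x\<in>E. \<forall>y\<in>E. f (x + y) = f x + f y) \<and>
    (\<forall>c. \<forall>x\<in>E. f (s1 c x) = s2 c (f x)) \<and>
    (\<exists>K. \<forall>x\<in>E. norm (f x) \<le> K * norm x)}"

lemma bounded_ops_UNIV:
  assumes "hilbert_space s1 ip1" "hilbert_space s2 ip2"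
  shows "T \<in> bounded_ops s1 UNIV s2 UNIV \<longleftrightarrow> Vector_Spaces.linear s1 s2 T \<and> bounded_linear T"
proof -
  interpret H1: hilbert_space s1 ip1 by fact
  interpret H2: hilbert_space s2 ip2 by fact
  have M: "module s1" "module s2" by unfold_locales
  have *: "T (r *\<^sub>R x) = r *\<^sub>R T x" if "\<And>c x. T (s1 c x) = s2 c (T x)" for r x
    using that[of "of_real r" x] by (simp add: H1.scale_of_real H2.scale_of_real)
  have lin: "Vector_Spaces.linear s1 s2 T \<longleftrightarrow>
      (\<forall>x y. T (x + y) = T x + T y) \<and> (\<forall>c x. T (s1 c x) = s2 c (T x))"
    by (simp add: Vector_Spaces.linear_iff_module_hom module_hom_iff M)
  show ?thesis
  proof
    assume "T \<in> bounded_ops s1 UNIV s2 UNIV"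
    then obtain K where add: "\<And>x y. T (x + y) = T x + T y" and scale: "\<And>c x. T (s1 c x) = s2 c (T x)"
      and K: "\<And>x. norm (T x) \<le> K * norm x"
      by (auto simp: bounded_ops_def)
    have "bounded_linear T"
      by (rule bounded_linear_intro[where K = K]) (use add *[OF scale] K in \<open>auto simp: mult.commute\<close>)
    then show "Vector_Spaces.linear s1 s2 T \<and> bounded_linear T" by (simp add: lin add scale)
  next
    assume "Vector_Spaces.linear s1 s2 T \<and> bounded_linear T"
    moreover from this obtain K where "\<forall>x. norm (T x) \<le> norm x * K"
      using bounded_linear.bounded by blast
    ultimately show "T \<in> bounded_ops s1 UNIV s2 UNIV"
      by (auto simp: bounded_ops_def lin mult.commute)
  qed
qed

definition adj ::
  "('a \<Rightarrow> 'a \<Rightarrow> 'k) \<Rightarrow> 'a set \<Rightarrow> ('b \<Rightarrow> 'b \<Rightarrow> 'k) \<Rightarrow> 'b set \<Rightarrow> ('a \<Rightarrow> 'b) \<Rightarrow> 'b \<Rightarrow> 'a"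
  where "adj ip1 E ip2 F f =
    (\<lambda>y\<in>F. THE z. z \<in> E \<and> (\<forall>x\<in>E. ip2 (f x) y = ip1 x z))"

text \<open>The order between self-adjoint operators on \<open>E\<close>.\<close>

definition op_le ::
  "('a::minus \<Rightarrow> 'a \<Rightarrow> 'k::real_normed_field) \<Rightarrow> 'a set \<Rightarrow> ('a \<Rightarrow> 'a) \<Rightarrow> ('a \<Rightarrow> 'a) \<Rightarrow> bool"
  where "op_le ip E P Q \<longleftrightarrow> (\<forall>x\<in>E. ip (Q x - P x) x \<in> \<real>\<^sub>\<ge>\<^sub>0)"

text \<open>
  The reduced solution of \<open>A = B X\<close> for \<open>A\<close> defined on \<open>E\<close> and \<open>B\<close>
  defined on \<open>F\<close>; the orthogonal complement of the null space of \<open>B\<close> within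
  \<open>F\<close> is \<open>orth ip2 {y \<in> F. B y = 0} \<inter> F\<close>.
\<close>

definition douglas_reduced ::
  "('k \<Rightarrow> 'a::real_normed_vector \<Rightarrow> 'a) \<Rightarrow> 'a set \<Rightarrow>
   ('k \<Rightarrow> 'b::real_normed_vector \<Rightarrow> 'b) \<Rightarrow> ('b \<Rightarrow> 'b \<Rightarrow> 'k::zero) \<Rightarrow> 'b set \<Rightarrow>
   ('a \<Rightarrow> 'c::zero) \<Rightarrow> ('b \<Rightarrow> 'c) \<Rightarrow> 'a \<Rightarrow> 'b"
  where "douglas_reduced s1 E s2 ip2 F A B =
    (THE Z. Z \<in> bounded_ops s1 E s2 F \<and> A = compose E B Z \<and>
            Z ` E \<subseteq> orth ip2 {y \<in> F. B y = 0} \<inter> F)"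


section \<open>Block operators and Schur complements\<close>

definition block :: "('b::minus \<Rightarrow> 'b \<Rightarrow> 'k::zero) \<Rightarrow> 'a set \<Rightarrow> 'b set \<Rightarrow> ('a \<Rightarrow> 'b) \<Rightarrow> 'a \<Rightarrow> 'b"
  where "block ip2 E F T = (\<lambda>x\<in>E. proj ip2 F (T x))"

definition block_matrix ::
  "('a::minus \<Rightarrow> 'a \<Rightarrow> 'k::zero) \<Rightarrow> 'a set \<Rightarrow>
   ('a \<Rightarrow> 'b::plus) \<Rightarrow> ('a \<Rightarrow> 'b) \<Rightarrow> ('a \<Rightarrow> 'b) \<Rightarrow> ('a \<Rightarrow> 'b) \<Rightarrow> 'a \<Rightarrow> 'b"
  where "block_matrix ip1 M A B C D x =
    (let u = proj ip1 M x; v = proj ip1 (orth ip1 M) x in (A u + B v) + (C u + D v))"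

definition complementable ::
  "('a::minus \<Rightarrow> 'a \<Rightarrow> 'k::zero) \<Rightarrow> ('b::minus \<Rightarrow> 'b \<Rightarrow> 'k) \<Rightarrow> 'a set \<Rightarrow> 'b set \<Rightarrow> ('a \<Rightarrow> 'b) \<Rightarrow> bool"
  where "complementable ip1 ip2 M N T \<longleftrightarrow>
    (let M' = orth ip1 M; N' = orth ip2 N;
         B = block ip2 M' N T; C = block ip2 M N' T; D = block ip2 M' N' T
     in C ` M \<subseteq> D ` M' \<and> adj ip1 M' ip2 N B ` N \<subseteq> adj ip1 M' ip2 N' D ` N')"

definition schur_complement ::
  "('k \<Rightarrow> 'a::real_normed_vector \<Rightarrow> 'a) \<Rightarrow> ('a \<Rightarrow> 'a \<Rightarrow> 'k::zero) \<Rightarrow>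
   ('b::real_normed_vector \<Rightarrow> 'b \<Rightarrow> 'k) \<Rightarrow> 'a set \<Rightarrow> 'b set \<Rightarrow> ('a \<Rightarrow> 'b) \<Rightarrow> 'a \<Rightarrow> 'b"
  where "schur_complement s1 ip1 ip2 M N T =
    (let M' = orth ip1 M; N' = orth ip2 N;
         A = block ip2 M N T; B = block ip2 M' N T;
         C = block ip2 M N' T; D = block ip2 M' N' T;
         Z = douglas_reduced s1 M s1 ip1 M' C D
     in block_matrix ip1 M (\<lambda>x\<in>M. A x - B (Z x)) (\<lambda>x\<in>M'. 0) (\<lambda>x\<in>M. 0) (\<lambda>x\<in>M'. 0))"

end

theory Submission
  imports Defs
begin

text \<open>
  All nine conditions speak about one operator. Write \<open>A\<^sup>*\<close> for the adjoint of \<open>A\<close>. For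
  \<open>x \<in> N\<close> the vector \<open>T\<^sup>* x\<close> has the orthogonal components \<open>A\<^sup>* x\<close> in \<open>M\<close> and \<open>B\<^sup>* x\<close> in its
  complement (\<open>norm_sq_adj_eq_blocks\<close>), while the adjoint of the Schur complement sends \<open>x\<close> to
  \<open>S\<^sup>* x\<close>. Hence the difference of the squared norms compared in (a) is the quadratic form of
  \<open>B B\<^sup>* + A A\<^sup>* - S S\<^sup>*\<close>, the difference of the two sides of (c).

  To see that this is the operator \<open>Q\<close> of (b), the Schur complement is expressed by the given
  solution \<open>X\<close>: \<open>S = A - B X\<close> (\<open>schur_complement_eq\<close>). The reduced solution is \<open>X\<close> with its
  values projected off the kernel of \<open>D\<close> (\<open>douglas_reduced_eq\<close>), and \<open>B\<close> vanishes on that kernel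
  because the range of \<open>B\<^sup>*\<close> is contained in that of \<open>D\<^sup>*\<close> (\<open>kernel_mono_of_adj_range\<close>).
  Expanding \<open>S S\<^sup>* = (A - B X) (A\<^sup>* - X\<^sup>* B\<^sup>*)\<close> in this difference cancels \<open>A A\<^sup>*\<close> and leaves \<open>Q\<close>.

  The two inequalities follow at once. For equality, a vanishing quadratic form must force the
  operator to vanish; over the reals this rests on the symmetry of \<open>Q\<close>
  (\<open>symmetric_form_zero_imp_zero\<close>).

  Adjoints and projections are given by definite descriptions, so their defining properties
  have to be established for the axiomatic Hilbert spaces at hand: orthogonal projections exist
  by completeness (\<open>nearest_point_exists\<close>), and adjoints exist by the Riesz representation of
  bounded functionals on closed subspaces (\<open>riesz_representation\<close>).
\<close>

section \<open>Bounded operators between subspaces\<close>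

lemma bounded_opsD:
  assumes "f \<in> bounded_ops s1 E s2 F"
  shows bounded_ops_closed: "x \<in> E \<Longrightarrow> f x \<in> F"
    and bounded_ops_extensional: "f \<in> extensional E"
    and bounded_ops_add: "x \<in> E \<Longrightarrow> y \<in> E \<Longrightarrow> f (x + y) = f x + f y"
    and bounded_ops_scale: "x \<in> E \<Longrightarrow> f (s1 c x) = s2 c (f x)"
    and bounded_ops_bound: "\<exists>K. \<forall>x\<in>E. norm (f x) \<le> K * norm x"
  using assms by (auto simp: bounded_ops_def PiE_def)

lemma bounded_opsI:
  assumes "\<And>x. x \<in> E \<Longrightarrow> f x \<in> F" "f \<in> extensional E"
    and "\<And>x y. x \<in> E \<Longrightarrow> y \<in> E \<Longrightarrow> f (x + y) = f x + f y"
    and "\<And>c x. x \<in> E \<Longrightarrow> f (s1 c x) = s2 c (f x)"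
    and "\<And>x. x \<in> E \<Longrightarrow> norm (f x) \<le> K * norm x"
  shows "f \<in> bounded_ops s1 E s2 F"
proof -
  have "\<exists>K. \<forall>x\<in>E. norm (f x) \<le> K * norm x" using assms(5) by blast
  then show ?thesis unfolding bounded_ops_def using assms(1-4) by (simp add: PiE_def)
qed


section \<open>Orthogonal projection and the Riesz representation\<close>

context hilbert_space
begin

lemma ip_add_right: "ip x (y + z) = ip x y + ip x z"
  by (metis ip_add_left ip_cj cj_add)

lemma ip_scale_right: "ip x (scale c y) = cj c * ip x y"
  by (metis ip_scale_left ip_cj cj_mult)

lemma ip_zero_left [simp]: "ip 0 y = 0"
  using ip_add_left[of 0 0 y] by simp

lemma ip_zero_right [simp]: "ip x 0 = 0"
  using ip_add_right[of x 0 0] by simp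

lemma ip_diff_left: "ip (x - y) z = ip x z - ip y z"
  using ip_add_left[of "x - y" y z] by simp

lemma ip_diff_right: "ip x (y - z) = ip x y - ip x z"
  using ip_add_right[of x "y - z" z] by simp

lemma ip_eq_0_commute: "ip x y = 0 \<longleftrightarrow> ip y x = 0"
  by (metis ip_cj cj_0)

lemma ip_self_eq_0: "ip x x = 0 \<longleftrightarrow> x = 0"
  by (simp add: ip_self)

lemma norm_add_sq:
  "of_real ((norm (x + y))\<^sup>2) = of_real ((norm x)\<^sup>2) + ip x y + ip y x + of_real ((norm y)\<^sup>2)"
  unfolding ip_self[symmetric] by (simp add: ip_add_left ip_add_right)

lemma norm_diff_sq:
  "of_real ((norm (x - y))\<^sup>2) = of_real ((norm x)\<^sup>2) - ip x y - ip y x + of_real ((norm y)\<^sup>2)"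
  unfolding ip_self[symmetric] by (simp add: ip_diff_left ip_diff_right)

lemma parallelogram:
  fixes x y :: 'a
  shows "(norm (x + y))\<^sup>2 + (norm (x - y))\<^sup>2 = 2 * (norm x)\<^sup>2 + 2 * (norm y)\<^sup>2"
proof -
  have "of_real ((norm (x + y))\<^sup>2) + of_real ((norm (x - y))\<^sup>2)
      = of_real (2 * (norm x)\<^sup>2) + (of_real (2 * (norm y)\<^sup>2) :: 'k)"
    unfolding norm_add_sq[of x y] norm_diff_sq by (simp del: of_real_power)
  then show ?thesis by (simp only: of_real_eq_iff flip: of_real_add)
qed

lemma pythagoras:
  assumes "ip x y = 0"
  shows "(norm (x + y))\<^sup>2 = (norm x)\<^sup>2 + (norm y)\<^sup>2"
proof -
  have "of_real ((norm (x + y))\<^sup>2) = of_real ((norm x)\<^sup>2) + (of_real ((norm y)\<^sup>2) :: 'k)"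
    unfolding norm_add_sq using assms ip_eq_0_commute[of x y] by simp
  then show ?thesis by (simp only: of_real_eq_iff flip: of_real_add)
qed

text \<open>
  Removing from \<open>x\<close> its component along \<open>y\<close> shortens it by an explicit amount. That this
  amount cannot exceed the square of \<open>norm x\<close> is the Cauchy-Schwarz inequality; that it must vanish when
  \<open>x\<close> is already shortest makes a nearest point an orthogonal projection.
\<close>

lemma norm_remove_component:
  assumes "y \<noteq> 0"
  shows "(norm (x - scale (ip x y / of_real ((norm y)\<^sup>2)) y))\<^sup>2
    = (norm x)\<^sup>2 - (norm (ip x y))\<^sup>2 / (norm y)\<^sup>2"
proof -
  define c where "c = ip x y / of_real ((norm y)\<^sup>2)"
  have c: "c * of_real ((norm y)\<^sup>2) = ip x y" using assms by (simp add: c_def)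
  have orthogonal: "ip (x - scale c y) (scale c y) = 0"
    using c by (simp add: ip_diff_left ip_scale_left ip_scale_right ip_self)
  have scaled: "(norm (scale c y))\<^sup>2 = (norm (ip x y))\<^sup>2 / (norm y)\<^sup>2"
  proof -
    have "of_real ((norm (scale c y))\<^sup>2) = (c * cj c) * ip y y"
      unfolding ip_self[symmetric] by (simp add: ip_scale_left ip_scale_right)
    also have "\<dots> = of_real ((norm c)\<^sup>2 * (norm y)\<^sup>2)" by (simp add: mult_cj ip_self)
    finally have "(norm (scale c y))\<^sup>2 = (norm c)\<^sup>2 * (norm y)\<^sup>2" by (simp only: of_real_eq_iff)
    moreover have "norm c = norm (ip x y) / (norm y)\<^sup>2"
      by (simp add: c_def norm_divide del: of_real_power)
    ultimately show ?thesis using assms by (simp add: field_simps power2_eq_square)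
  qed
  have "(norm x)\<^sup>2 = (norm (x - scale c y))\<^sup>2 + (norm (scale c y))\<^sup>2"
    using pythagoras[OF orthogonal] by simp
  then show ?thesis using scaled by (simp add: c_def)
qed

lemma cauchy_schwarz: "norm (ip x y) \<le> norm x * norm y"
proof (cases "y = 0")
  case False
  have "0 \<le> (norm x)\<^sup>2 - (norm (ip x y))\<^sup>2 / (norm y)\<^sup>2"
    using norm_remove_component[OF False, of x] by (metis zero_le_power2)
  then have "(norm (ip x y))\<^sup>2 \<le> (norm x * norm y)\<^sup>2"
    using False by (simp add: field_simps power_mult_distrib)
  then show ?thesis by (rule power2_le_imp_le) simp
qed simp

lemma continuous_ip_right: "continuous_on UNIV (\<lambda>y. ip x y)"
proof -
  have "bounded_linear (\<lambda>y. ip x y)"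
  proof (rule bounded_linear_intro[where K = "norm x"])
    show "ip x (r *\<^sub>R y) = r *\<^sub>R ip x y" for r y
      by (simp add: ip_scale_right scaleR_conv_of_real flip: scale_of_real)
    show "norm (ip x y) \<le> norm y * norm x" for y
      using cauchy_schwarz[of x y] by (simp only: mult.commute)
  qed (rule ip_add_right)
  then show ?thesis by (rule linear_continuous_on)
qed

lemma orthI: "(\<And>x. x \<in> M \<Longrightarrow> ip x y = 0) \<Longrightarrow> y \<in> orth ip M"
  by (simp add: orth_def)

lemma orthD: "y \<in> orth ip M \<Longrightarrow> x \<in> M \<Longrightarrow> ip x y = 0"
  by (simp add: orth_def)

lemma subspace_orth: "subspace (orth ip M)"
  by (rule subspaceI) (auto simp: orth_def ip_add_right ip_scale_right)

lemma closed_orth: "closed (orth ip M)"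
proof -
  have "closed (\<Inter>x\<in>M. {y. ip x y = 0})"
    by (intro closed_INT ballI closed_Collect_eq continuous_ip_right continuous_on_const)
  moreover have "(\<Inter>x\<in>M. {y. ip x y = 0}) = orth ip M" by (auto simp: orth_def)
  ultimately show ?thesis by simp
qed

lemma orth_trivial: "x \<in> M \<Longrightarrow> x \<in> orth ip M \<Longrightarrow> x = 0"
  using ip_self_eq_0 orthD by blast

lemma ip_right_cancel:
  assumes "subspace E" "z \<in> E" "w \<in> E" "\<And>x. x \<in> E \<Longrightarrow> ip x z = ip x w"
  shows "z = w"
proof -
  have "z - w \<in> E" using assms subspace_diff by blast
  moreover from this have "z - w \<in> orth ip E"
    by (intro orthI) (simp add: assms ip_diff_right)
  ultimately show ?thesis using orth_trivial by fastforce
qed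

text \<open>
  The approximate minimisers of the squared distance to \<open>x\<close> form shrinking nonempty closed
  subsets of \<open>M\<close>; by the parallelogram law applied at midpoints their diameters tend to
  zero, so completeness yields a common point, which is a nearest point.
\<close>

lemma nearest_point_exists:
  assumes M: "subspace M" "closed M"
  shows "\<exists>a\<in>M. \<forall>m\<in>M. (norm (x - a))\<^sup>2 \<le> (norm (x - m))\<^sup>2"
proof -
  define d where "d = (INF m\<in>M. (norm (x - m))\<^sup>2)"
  have bdd: "bdd_below ((\<lambda>m. (norm (x - m))\<^sup>2) ` M)"
    by (rule bdd_belowI2[of _ 0]) simp
  have d: "d \<le> (norm (x - m))\<^sup>2" if "m \<in> M" for m
    unfolding d_def using bdd that by (rule cINF_lower)
  define S where "S n = {m\<in>M. (norm (x - m))\<^sup>2 \<le> d + inverse (real (Suc n))}" for n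
  have "closed (S n)" for n
  proof -
    have "closed {m. (norm (x - m))\<^sup>2 \<le> d + inverse (real (Suc n))}"
      by (intro closed_Collect_le continuous_intros)
    moreover have "S n = M \<inter> {m. (norm (x - m))\<^sup>2 \<le> d + inverse (real (Suc n))}"
      by (auto simp: S_def)
    ultimately show ?thesis using M by (simp add: closed_Int)
  qed
  moreover have "S n \<noteq> {}" for n
  proof -
    have "M \<noteq> {}" using subspace_0[OF M(1)] by auto
    moreover have "d < d + inverse (real (Suc n))" by simp
    ultimately obtain m where "m \<in> M" "(norm (x - m))\<^sup>2 < d + inverse (real (Suc n))"
      unfolding d_def using cINF_less_iff[OF _ bdd] by blast
    then show ?thesis by (force simp: S_def)
  qed
  moreover have "S n \<subseteq> S m" if "m \<le> n" for m n
    using that by (auto simp: S_def intro: order_trans le_imp_inverse_le)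
  moreover have "\<exists>n. \<forall>m\<in>S n. \<forall>m'\<in>S n. dist m m' < e" if e: "e > 0" for e
  proof -
    obtain n where n: "inverse (real (Suc n)) < e\<^sup>2 / 4"
      using reals_Archimedean[of "e\<^sup>2 / 4"] e by auto
    have "dist m m' < e" if m: "m \<in> S n" "m' \<in> S n" for m m'
    proof -
      have mM: "m \<in> M" "m' \<in> M" using m by (auto simp: S_def)
      define h where "h = (1/2) *\<^sub>R (m + m')"
      have "h \<in> M"
        unfolding h_def scale_of_real[symmetric] using M(1) mM by (intro subspace_scale subspace_add)
      then have "d \<le> (norm (x - h))\<^sup>2" by (rule d)
      moreover have "(x - m) + (x - m') = 2 *\<^sub>R (x - h)"
        by (simp add: h_def algebra_simps scaleR_2)
      then have "(norm ((x - m) + (x - m')))\<^sup>2 = 4 * (norm (x - h))\<^sup>2"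
        by (simp add: power_mult_distrib)
      moreover have "norm ((x - m) - (x - m')) = dist m m'"
        by (simp add: dist_norm norm_minus_commute)
      ultimately have "(dist m m')\<^sup>2 \<le> 2 * (norm (x - m))\<^sup>2 + 2 * (norm (x - m'))\<^sup>2 - 4 * d"
        using parallelogram[of "x - m" "x - m'"] by simp
      also have "\<dots> \<le> 4 * inverse (real (Suc n))" using m by (simp add: S_def)
      also have "\<dots> < e\<^sup>2" using n by simp
      finally show ?thesis using e by (simp add: power2_less_imp_less)
    qed
    then show ?thesis by blast
  qed
  ultimately obtain a where a: "\<And>n. a \<in> S n"
    using decreasing_closed_nest[of S] by blast
  then have "a \<in> M" by (auto simp: S_def)
  moreover have "(norm (x - a))\<^sup>2 \<le> d"
  proof (rule field_le_epsilon)
    fix e :: real assume "e > 0"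
    then obtain n where "inverse (real (Suc n)) < e" using reals_Archimedean by blast
    with a[of n] show "(norm (x - a))\<^sup>2 \<le> d + e" by (simp add: S_def)
  qed
  ultimately show ?thesis using d order_trans by blast
qed

lemma orth_decomposition_exists:
  assumes M: "subspace M" "closed M"
  shows "\<exists>a\<in>M. x - a \<in> orth ip M"
proof -
  obtain a where a: "a \<in> M" and nearest: "\<And>m. m \<in> M \<Longrightarrow> (norm (x - a))\<^sup>2 \<le> (norm (x - m))\<^sup>2"
    using nearest_point_exists[OF M] by blast
  have "ip v (x - a) = 0" if v: "v \<in> M" for v
  proof (cases "v = 0")
    case False
    define c where "c = ip (x - a) v / of_real ((norm v)\<^sup>2)"
    have "a + scale c v \<in> M" using M(1) a v by (intro subspace_add subspace_scale)
    then have "(norm (x - a))\<^sup>2 \<le> (norm ((x - a) - scale c v))\<^sup>2"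
      using nearest[of "a + scale c v"] by (simp add: diff_diff_eq)
    also have "\<dots> = (norm (x - a))\<^sup>2 - (norm (ip (x - a) v))\<^sup>2 / (norm v)\<^sup>2"
      unfolding c_def using False by (rule norm_remove_component)
    finally have "(norm (ip (x - a) v))\<^sup>2 / (norm v)\<^sup>2 \<le> 0" by simp
    with False have "ip (x - a) v = 0" by (simp add: divide_le_0_iff)
    then show ?thesis using ip_eq_0_commute by blast
  qed simp
  with a show ?thesis by (auto intro: orthI)
qed

lemma proj_eqI:
  assumes M: "subspace M" and y: "y \<in> M" "x - y \<in> orth ip M"
  shows "proj ip M x = y"
  unfolding proj_def
proof (rule the_equality)
  fix z assume z: "z \<in> M \<and> x - z \<in> orth ip M"
  have "z - y \<in> M" using M y z subspace_diff by blast
  moreover have "(x - y) - (x - z) \<in> orth ip M" using subspace_orth y z subspace_diff by blast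
  then have "z - y \<in> orth ip M" by simp
  ultimately show "z = y" using orth_trivial by fastforce
qed (use y in auto)

lemma
  assumes "subspace M" "closed M"
  shows proj_in: "proj ip M x \<in> M" and diff_proj_orth: "x - proj ip M x \<in> orth ip M"
proof -
  obtain a where a: "a \<in> M" "x - a \<in> orth ip M" using orth_decomposition_exists[OF assms] by blast
  moreover have "proj ip M x = a" using assms(1) a by (rule proj_eqI)
  ultimately show "proj ip M x \<in> M" and "x - proj ip M x \<in> orth ip M" by simp_all
qed

lemma proj_add:
  assumes M: "subspace M" "closed M"
  shows "proj ip M (x + y) = proj ip M x + proj ip M y"
proof (rule proj_eqI[OF M(1)])
  have "(x - proj ip M x) + (y - proj ip M y) \<in> orth ip M"
    using M by (intro subspace_add subspace_orth diff_proj_orth)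
  then show "x + y - (proj ip M x + proj ip M y) \<in> orth ip M" by (simp add: algebra_simps)
qed (use M in \<open>intro subspace_add proj_in\<close>)

lemma proj_scale:
  assumes M: "subspace M" "closed M"
  shows "proj ip M (scale c x) = scale c (proj ip M x)"
proof (rule proj_eqI[OF M(1)])
  have "scale c (x - proj ip M x) \<in> orth ip M"
    using M by (intro subspace_scale subspace_orth diff_proj_orth)
  then show "scale c x - scale c (proj ip M x) \<in> orth ip M" by (simp add: scale_right_diff_distrib)
qed (use M in \<open>intro subspace_scale proj_in\<close>)

lemma norm_sq_proj:
  assumes M: "subspace M" "closed M"
  shows "(norm x)\<^sup>2 = (norm (proj ip M x))\<^sup>2 + (norm (x - proj ip M x))\<^sup>2"
  using pythagoras[OF orthD[OF diff_proj_orth[OF M] proj_in[OF M]], of x x] by simp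

lemma norm_proj_le:
  assumes M: "subspace M" "closed M"
  shows "norm (proj ip M x) \<le> norm x" "norm (x - proj ip M x) \<le> norm x"
  by (rule power2_le_imp_le; simp add: norm_sq_proj[OF M, of x])+

lemma proj_ident: "subspace M \<Longrightarrow> x \<in> M \<Longrightarrow> proj ip M x = x"
  using subspace_orth subspace_0 by (intro proj_eqI) auto

lemma ip_proj_left:
  assumes M: "subspace M" "closed M" and y: "y \<in> M"
  shows "ip (proj ip M x) y = ip x y"
proof -
  have "ip y (x - proj ip M x) = 0" by (rule orthD[OF diff_proj_orth[OF M] y])
  then have "ip (x - proj ip M x) y = 0" using ip_eq_0_commute by blast
  then show ?thesis by (simp add: ip_diff_left)
qed

lemma bounded_ops_diff:
  assumes f: "f \<in> bounded_ops scale E s2 F" and E: "subspace E" and "x \<in> E" "y \<in> E"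
  shows "f (x - y) = f x - f y"
  using bounded_ops_add[OF f, of "x - y" y] assms subspace_diff by simp

lemma bounded_ops_zero:
  assumes f: "f \<in> bounded_ops scale E s2 F" and E: "subspace E"
  shows "f 0 = 0"
  using bounded_ops_diff[OF f E subspace_0[OF E] subspace_0[OF E]] by simp

lemma subspace_kernel:
  assumes f: "f \<in> bounded_ops scale E s2 F" and E: "subspace E" and s2: "\<And>c. s2 c 0 = 0"
  shows "subspace {x\<in>E. f x = 0}"
  using subspace_0[OF E] subspace_add[OF E] subspace_scale[OF E] bounded_ops_zero[OF f E] s2
  by (intro subspaceI) (auto simp: bounded_ops_add[OF f] bounded_ops_scale[OF f])

lemma closed_kernel:
  assumes f: "f \<in> bounded_ops scale E s2 F" and E: "subspace E" "closed E"
  shows "closed {x\<in>E. f x = 0}"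
proof -
  obtain K where K: "\<And>x. x \<in> E \<Longrightarrow> norm (f x) \<le> K * norm x" using bounded_ops_bound[OF f] by blast
  have "f x = 0" if seq: "\<And>n. u n \<in> E \<and> f (u n) = 0" "u \<longlonglongrightarrow> x" and x: "x \<in> E" for u x
  proof -
    have "norm (f x) \<le> K * norm (x - u n)" for n
      using K[of "x - u n"] bounded_ops_diff[OF f E(1) x, of "u n"] subspace_diff[OF E(1) x] seq(1)[of n]
      by simp
    moreover have "(\<lambda>n. K * norm (x - u n)) \<longlonglongrightarrow> K * norm (x - x)"
      using seq(2) by (intro tendsto_intros)
    ultimately have "norm (f x) \<le> K * norm (x - x)" by (meson LIMSEQ_le_const)
    then show ?thesis by simp
  qed
  moreover have "x \<in> E" if "\<And>n. u n \<in> E" "u \<longlonglongrightarrow> x" for u x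
    using closed_sequentially[OF E(2)] that by blast
  ultimately show ?thesis unfolding closed_sequential_limits by blast
qed

text \<open>
  The kernel of a nonzero functional has a nonzero orthogonal vector \<open>w\<close> in \<open>E\<close>, and every
  \<open>x\<close> differs from a multiple of \<open>w\<close> by an element of the kernel; hence pairing with a suitable
  multiple of \<open>w\<close> reproduces the functional.
\<close>

lemma riesz_representation:
  assumes f: "f \<in> bounded_ops scale E (*) F" and E: "subspace E" "closed E"
  shows "\<exists>z\<in>E. \<forall>x\<in>E. f x = ip x z"
proof (cases "\<forall>x\<in>E. f x = 0")
  case True
  then show ?thesis using subspace_0[OF E(1)] by (intro bexI[of _ 0]) auto
next
  case False
  then obtain v where v: "v \<in> E" "f v \<noteq> 0" by blast
  define L where "L = {x\<in>E. f x = 0}"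
  have L: "subspace L" "closed L"
    unfolding L_def using subspace_kernel[OF f E(1)] closed_kernel[OF f E] by auto
  define w where "w = v - proj ip L v"
  have pL: "proj ip L v \<in> E" "f (proj ip L v) = 0" using proj_in[OF L, of v] by (auto simp: L_def)
  have wE: "w \<in> E" using pL v subspace_diff[OF E(1)] by (simp add: w_def)
  have fw: "f w \<noteq> 0" using v pL bounded_ops_diff[OF f E(1)] by (simp add: w_def)
  then have w0: "w \<noteq> 0" using bounded_ops_zero[OF f E(1)] by metis
  have wL: "w \<in> orth ip L" unfolding w_def by (rule diff_proj_orth[OF L])
  define z where "z = scale (cj (f w) / of_real ((norm w)\<^sup>2)) w"
  have "f x = ip x z" if x: "x \<in> E" for x
  proof -
    define c where "c = f x / f w"
    have cw: "scale c w \<in> E" using wE subspace_scale[OF E(1)] by blast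
    have "f (x - scale c w) = f x - c * f w"
      by (simp add: bounded_ops_diff[OF f E(1) x cw] bounded_ops_scale[OF f wE])
    also have "\<dots> = 0" using fw by (simp add: c_def)
    finally have "f (x - scale c w) = 0" .
    then have "x - scale c w \<in> L" using x cw subspace_diff[OF E(1)] by (simp add: L_def)
    then have "ip x w = c * of_real ((norm w)\<^sup>2)"
      using orthD[OF wL] by (fastforce simp: ip_diff_left ip_scale_left ip_self)
    moreover have "cj (cj (f w) / of_real ((norm w)\<^sup>2)) = f w / of_real ((norm w)\<^sup>2)"
    proof -
      have "cj (f w) / of_real ((norm w)\<^sup>2) = cj (f w) * of_real (1 / (norm w)\<^sup>2)" by simp
      then show ?thesis by (simp only: cj_mult cj_cj cj_of_real) simp
    qed
    ultimately show ?thesis using fw w0 by (simp add: z_def ip_scale_right c_def)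
  qed
  moreover have "z \<in> E" unfolding z_def using wE subspace_scale[OF E(1)] by blast
  ultimately show ?thesis by blast
qed

text \<open>
  Over the reals the quadratic form of an operator does not determine it, so symmetry is
  essential: it makes the form at \<open>x + R x\<close> equal to \<open>2 * norm (R x) ^ 2\<close> when the form
  vanishes at \<open>x\<close> and at \<open>R x\<close>.
\<close>

lemma symmetric_form_zero_imp_zero:
  assumes E: "subspace E"
    and R: "\<And>x. x \<in> E \<Longrightarrow> R x \<in> E"
    and sym: "\<And>x y. x \<in> E \<Longrightarrow> y \<in> E \<Longrightarrow> ip (R x) y = ip x (R y)"
    and zero: "\<And>x. x \<in> E \<Longrightarrow> ip (R x) x = 0"
    and x: "x \<in> E"
  shows "R x = 0"
proof -
  define y where "y = R x"
  have y: "y \<in> E" "x + y \<in> E" using R x subspace_add[OF E] by (auto simp: y_def)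
  have "0 = ip (R (x + y)) (x + y)" using zero y by simp
  also have "\<dots> = ip (x + y) (R x) + ip (x + y) (R y)" using sym x y by (simp add: ip_add_right)
  also have "\<dots> = ip (R x) x + ip y y + ip y y + ip (R y) y"
    using sym[of x x] sym[of x y] sym[of y y] x y by (simp add: ip_add_left flip: y_def)
  also have "\<dots> = of_real (2 * (norm y)\<^sup>2)" using zero x y by (simp add: ip_self)
  finally have "of_real (2 * (norm y)\<^sup>2) = (of_real 0 :: 'k)" by simp
  then show ?thesis unfolding of_real_eq_iff by (simp add: y_def)
qed

end


section \<open>Adjoints, blocks and Douglas reduced solutions\<close>

locale hilbert_pair = H1: hilbert_space s1 ip1 + H2: hilbert_space s2 ip2
  for s1 :: "'k::real_or_complex \<Rightarrow> 'a::banach \<Rightarrow> 'a" and ip1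
    and s2 :: "'k \<Rightarrow> 'b::banach \<Rightarrow> 'b" and ip2
begin

lemma adj_eqI:
  assumes "H1.subspace E" "y \<in> F" "z \<in> E" "\<And>x. x \<in> E \<Longrightarrow> ip2 (f x) y = ip1 x z"
  shows "adj ip1 E ip2 F f y = z"
proof -
  have "(THE z. z \<in> E \<and> (\<forall>x\<in>E. ip2 (f x) y = ip1 x z)) = z"
    using assms by (intro the_equality) (auto intro: H1.ip_right_cancel[OF assms(1)])
  then show ?thesis using assms(2) by (simp add: adj_def)
qed

text \<open>For each \<open>y\<close> the functional \<open>\<lambda>x. ip2 (f x) y\<close> is bounded, so it is represented by a vector.\<close>

lemma
  assumes f: "f \<in> bounded_ops s1 E s2 F" and E: "H1.subspace E" "closed E" and y: "y \<in> F"
  shows adj_in: "adj ip1 E ip2 F f y \<in> E"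
    and ip_adj: "x \<in> E \<Longrightarrow> ip2 (f x) y = ip1 x (adj ip1 E ip2 F f y)"
proof -
  obtain K where K: "\<And>x. x \<in> E \<Longrightarrow> norm (f x) \<le> K * norm x" using bounded_ops_bound[OF f] by blast
  have "norm (ip2 (f x) y) \<le> (K * norm y) * norm x" if "x \<in> E" for x
    using H2.cauchy_schwarz[of "f x" y] mult_right_mono[OF K[OF that], of "norm y"]
    by (simp add: ac_simps)
  then have "(\<lambda>x\<in>E. ip2 (f x) y) \<in> bounded_ops s1 E (*) UNIV"
    using H1.subspace_add[OF E(1)] H1.subspace_scale[OF E(1)]
    by (intro bounded_opsI[where K = "K * norm y"])
      (simp_all add: bounded_ops_add[OF f] bounded_ops_scale[OF f] H2.ip_add_left H2.ip_scale_left)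
  from H1.riesz_representation[OF this E]
  obtain z where z: "z \<in> E" "\<And>x. x \<in> E \<Longrightarrow> ip2 (f x) y = ip1 x z" by auto
  then have "adj ip1 E ip2 F f y = z" using E(1) y by (intro adj_eqI)
  with z show "adj ip1 E ip2 F f y \<in> E"
    and "x \<in> E \<Longrightarrow> ip2 (f x) y = ip1 x (adj ip1 E ip2 F f y)" by auto
qed

lemma block_bounded:
  assumes T: "T \<in> bounded_ops s1 UNIV s2 UNIV" and E: "H1.subspace E"
    and F: "H2.subspace F" "closed F"
  shows "block ip2 E F T \<in> bounded_ops s1 E s2 F"
proof -
  obtain K where K: "\<And>x. norm (T x) \<le> K * norm x" using bounded_ops_bound[OF T] by blast
  have "norm (proj ip2 F (T x)) \<le> K * norm x" for x
    using H2.norm_proj_le(1)[OF F] K by (rule order_trans)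
  then show ?thesis
    using H1.subspace_add[OF E] H1.subspace_scale[OF E]
    by (intro bounded_opsI[where K = K])
      (simp_all add: block_def H2.proj_in[OF F] H2.proj_add[OF F] H2.proj_scale[OF F]
        bounded_ops_add[OF T] bounded_ops_scale[OF T])
qed

text \<open>
  A vector \<open>y \<in> F\<close> sees only the blocks of \<open>T\<close> that map into \<open>F\<close>, and their adjoints
  take values in \<open>E\<close> and in its orthogonal complement.
\<close>

lemma norm_sq_adj_eq_blocks:
  assumes T: "T \<in> bounded_ops s1 UNIV s2 UNIV" and E: "H1.subspace E" "closed E"
    and F: "H2.subspace F" "closed F" and y: "y \<in> F"
  shows "(norm (adj ip1 UNIV ip2 UNIV T y))\<^sup>2
    = (norm (adj ip1 E ip2 F (block ip2 E F T) y))\<^sup>2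
    + (norm (adj ip1 (orth ip1 E) ip2 F (block ip2 (orth ip1 E) F T) y))\<^sup>2"
proof -
  define E' where "E' = orth ip1 E"
  have E': "H1.subspace E'" "closed E'" by (simp_all add: E'_def H1.subspace_orth H1.closed_orth)
  define a where "a = adj ip1 E ip2 F (block ip2 E F T) y"
  define b where "b = adj ip1 E' ip2 F (block ip2 E' F T) y"
  note A = block_bounded[OF T E(1) F] and B = block_bounded[OF T E'(1) F]
  have a: "a \<in> E" unfolding a_def by (rule adj_in[OF A E y])
  have b: "b \<in> E'" unfolding b_def by (rule adj_in[OF B E' y])
  have ab: "ip1 u b = 0" if "u \<in> E" for u
    using b that unfolding E'_def by (rule H1.orthD)
  have ba: "ip1 v a = 0" if "v \<in> E'" for v
  proof -
    have "ip1 a v = 0" using that a unfolding E'_def by (rule H1.orthD)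
    then show ?thesis using H1.ip_eq_0_commute by blast
  qed
  have "adj ip1 UNIV ip2 UNIV T y = a + b"
  proof (rule adj_eqI[OF H1.subspace_UNIV])
    fix x
    define u v where "u = proj ip1 E x" and "v = x - u"
    have uv: "u \<in> E" "v \<in> E'" "x = u + v"
      unfolding u_def v_def E'_def using H1.proj_in[OF E] H1.diff_proj_orth[OF E] by auto
    have "ip2 (T x) y = ip2 (T u) y + ip2 (T v) y"
      using uv bounded_ops_add[OF T, of u v] by (simp add: H2.ip_add_left)
    also have "\<dots> = ip2 (block ip2 E F T u) y + ip2 (block ip2 E' F T v) y"
      using uv by (simp add: block_def H2.ip_proj_left[OF F y])
    also have "\<dots> = ip1 u a + ip1 v b"
      unfolding a_def b_def using ip_adj[OF A E y uv(1)] ip_adj[OF B E' y uv(2)] by simp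
    also have "\<dots> = ip1 x (a + b)"
      using ab[OF uv(1)] ba[OF uv(2)] uv(3) by (simp add: H1.ip_add_left H1.ip_add_right)
    finally show "ip2 (T x) y = ip1 x (a + b)" .
  qed auto
  then have "(norm (adj ip1 UNIV ip2 UNIV T y))\<^sup>2 = (norm a)\<^sup>2 + (norm b)\<^sup>2"
    using H1.pythagoras[OF ab[OF a]] by simp
  then show ?thesis by (simp only: a_def b_def E'_def)
qed

text \<open>
  Any bounded solution \<open>X\<close> of a factorisation problem is corrected to the reduced one by
  projecting its values off the kernel of the left factor; a difference of two reduced
  solutions lies both in this kernel and in its orthogonal complement.
\<close>

lemma douglas_reduced_eq:
  assumes X: "X \<in> bounded_ops s1 E s1 F" and D: "D \<in> bounded_ops s1 F s2 G"
    and E: "H1.subspace E" and F: "H1.subspace F" "closed F"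
  shows "douglas_reduced s1 E s1 ip1 F (compose E D X) D
    = (\<lambda>x\<in>E. X x - proj ip1 {v\<in>F. D v = 0} (X x))"
  unfolding douglas_reduced_def
proof (rule the_equality)
  define L where "L = {v\<in>F. D v = 0}"
  have L: "H1.subspace L" "closed L"
    unfolding L_def using H1.subspace_kernel[OF D F(1)] H1.closed_kernel[OF D F] by auto
  define Z where "Z = (\<lambda>x\<in>E. X x - proj ip1 L (X x))"
  have XF: "X x \<in> F" if "x \<in> E" for x using bounded_ops_closed[OF X that] .
  have PL: "proj ip1 L v \<in> F" "D (proj ip1 L v) = 0" for v
    using H1.proj_in[OF L, of v] by (auto simp: L_def)
  have ZF: "Z x \<in> F" if "x \<in> E" for x
    using that XF PL H1.subspace_diff[OF F(1)] by (simp add: Z_def)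
  have DZ: "D (Z x) = D (X x)" if "x \<in> E" for x
    using that XF PL H1.bounded_ops_diff[OF D F(1)] by (simp add: Z_def)
  have Zorth: "Z x \<in> orth ip1 L" if "x \<in> E" for x
    using that H1.diff_proj_orth[OF L] by (simp add: Z_def)
  have "Z \<in> bounded_ops s1 E s1 F"
  proof -
    obtain K where K: "\<And>x. x \<in> E \<Longrightarrow> norm (X x) \<le> K * norm x" using bounded_ops_bound[OF X] by blast
    have "norm (Z x) \<le> K * norm x" if "x \<in> E" for x
      using H1.norm_proj_le(2)[OF L, of "X x"] K[OF that] that by (simp add: Z_def)
    moreover have "Z (x + y) = Z x + Z y" if "x \<in> E" "y \<in> E" for x y
      using that H1.subspace_add[OF E]
      by (simp add: Z_def bounded_ops_add[OF X] H1.proj_add[OF L])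
    moreover have "Z (s1 c x) = s1 c (Z x)" if "x \<in> E" for c x
      using that H1.subspace_scale[OF E]
      by (simp add: Z_def bounded_ops_scale[OF X] H1.proj_scale[OF L] H1.scale_right_diff_distrib)
    moreover have "Z \<in> extensional E" by (simp add: Z_def)
    ultimately show ?thesis using ZF by (intro bounded_opsI[where K = K])
  qed
  moreover have "compose E D X = compose E D Z"
    using DZ by (auto simp: compose_def)
  ultimately show "(\<lambda>x\<in>E. X x - proj ip1 {v\<in>F. D v = 0} (X x)) \<in> bounded_ops s1 E s1 F \<and>
      compose E D X = compose E D (\<lambda>x\<in>E. X x - proj ip1 {v\<in>F. D v = 0} (X x)) \<and>
      (\<lambda>x\<in>E. X x - proj ip1 {v\<in>F. D v = 0} (X x)) ` E \<subseteq> orth ip1 {y\<in>F. D y = 0} \<inter> F"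
    unfolding L_def[symmetric] Z_def[symmetric] using ZF Zorth by blast
  fix W assume W: "W \<in> bounded_ops s1 E s1 F \<and> compose E D X = compose E D W \<and>
      W ` E \<subseteq> orth ip1 {y\<in>F. D y = 0} \<inter> F"
  have "W = Z"
  proof (rule extensionalityI[of _ E])
    show "W \<in> extensional E" using W bounded_ops_extensional by blast
    fix x assume x: "x \<in> E"
    have WF: "W x \<in> F" "W x \<in> orth ip1 L" using W x unfolding L_def by auto
    have "D (W x) = D (Z x)" using W x DZ by (metis compose_eq)
    then have "W x - Z x \<in> L"
      using WF(1) ZF[OF x] H1.bounded_ops_diff[OF D F(1)] H1.subspace_diff[OF F(1)]
      by (simp add: L_def)
    moreover have "W x - Z x \<in> orth ip1 L"
      using WF(2) Zorth[OF x] H1.subspace_diff[OF H1.subspace_orth] by blast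
    ultimately show "W x = Z x" using H1.orth_trivial by fastforce
  qed (simp add: Z_def)
  then show "W = (\<lambda>x\<in>E. X x - proj ip1 {v\<in>F. D v = 0} (X x))" unfolding Z_def L_def .
qed

lemma ip_adj_adj:
  assumes f: "f \<in> bounded_ops s1 E s2 F" and E: "H1.subspace E" "closed E"
    and x: "x \<in> F" and y: "y \<in> F"
  shows "ip2 (f (adj ip1 E ip2 F f x)) y = ip1 (adj ip1 E ip2 F f x) (adj ip1 E ip2 F f y)"
  by (rule ip_adj[OF f E y adj_in[OF f E x]])

text \<open>
  The adjoint of \<open>B\<close> sends \<open>B v\<close> to some value of the adjoint of \<open>D\<close>, which is orthogonal to the
  kernel of \<open>D\<close> and thus to \<open>v\<close>; so \<open>B v\<close> is orthogonal to itself.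
\<close>

lemma kernel_mono_of_adj_range:
  assumes B: "B \<in> bounded_ops s1 E s2 F" and D: "D \<in> bounded_ops s1 E s2 G"
    and E: "H1.subspace E" "closed E"
    and range: "adj ip1 E ip2 F B ` F \<subseteq> adj ip1 E ip2 G D ` G"
    and v: "v \<in> E" "D v = 0"
  shows "B v = 0"
proof -
  have Bv: "B v \<in> F" using bounded_ops_closed[OF B v(1)] .
  with range obtain w where w: "w \<in> G" "adj ip1 E ip2 F B (B v) = adj ip1 E ip2 G D w" by blast
  have "ip2 (B v) (B v) = ip1 v (adj ip1 E ip2 G D w)"
    using ip_adj[OF B E Bv v(1)] w(2) by simp
  also have "\<dots> = ip2 (D v) w" using ip_adj[OF D E w(1) v(1)] by simp
  finally show ?thesis using v(2) by (simp add: H2.ip_self_eq_0)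
qed

text \<open>
  The reduced solution may be replaced by any bounded solution \<open>X\<close>: the two differ by values
  in the kernel of \<open>D\<close>, where \<open>B\<close> vanishes as well.
\<close>

lemma schur_complement_eq:
  assumes M: "H1.subspace M" "closed M" and N: "H2.subspace N" "closed N"
    and M': "M' = orth ip1 M" and N': "N' = orth ip2 N"
    and T: "T \<in> bounded_ops s1 UNIV s2 UNIV"
    and compl: "complementable ip1 ip2 M N T"
    and X: "X \<in> bounded_ops s1 M s1 M'" "block ip2 M N' T = compose M (block ip2 M' N' T) X"
  shows "schur_complement s1 ip1 ip2 M N T x =
    block ip2 M N T (proj ip1 M x) - block ip2 M' N T (X (proj ip1 M x))"
proof -
  define B where "B = block ip2 M' N T"
  define D where "D = block ip2 M' N' T"
  have sub': "H1.subspace M'" "closed M'" "H2.subspace N'" "closed N'"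
    by (simp_all add: M' N' H1.subspace_orth H1.closed_orth H2.subspace_orth H2.closed_orth)
  have B: "B \<in> bounded_ops s1 M' s2 N" unfolding B_def by (rule block_bounded[OF T sub'(1) N])
  have D: "D \<in> bounded_ops s1 M' s2 N'" unfolding D_def by (rule block_bounded[OF T sub'(1,3,4)])
  define L where "L = {v\<in>M'. D v = 0}"
  have L: "H1.subspace L" "closed L"
    unfolding L_def using H1.subspace_kernel[OF D sub'(1)] H1.closed_kernel[OF D sub'(1,2)] by auto
  define u where "u = proj ip1 M x"
  have u: "u \<in> M" unfolding u_def by (rule H1.proj_in[OF M])
  have v: "proj ip1 M' x \<in> M'" by (rule H1.proj_in[OF sub'(1,2)])
  have PL: "proj ip1 L (X u) \<in> M'" "D (proj ip1 L (X u)) = 0"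
    using H1.proj_in[OF L, of "X u"] by (auto simp: L_def)
  have "adj ip1 M' ip2 N B ` N \<subseteq> adj ip1 M' ip2 N' D ` N'"
    using compl by (simp add: complementable_def Let_def B_def D_def M' N')
  from kernel_mono_of_adj_range[OF B D sub'(1,2) this PL]
  have "B (X u - proj ip1 L (X u)) = B (X u)"
    using H1.bounded_ops_diff[OF B sub'(1) bounded_ops_closed[OF X(1) u] PL(1)] by simp
  moreover have "schur_complement s1 ip1 ip2 M N T x = block ip2 M N T u - B (X u - proj ip1 L (X u))"
    unfolding schur_complement_def block_matrix_def Let_def M'[symmetric] N'[symmetric] X(2)
    unfolding B_def[symmetric] D_def[symmetric] douglas_reduced_eq[OF X(1) D M(1) sub'(1,2)]
    unfolding L_def[symmetric] u_def[symmetric]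
    using u v by simp
  ultimately show ?thesis by (simp add: B_def u_def)
qed

end


section \<open>Comparison of the adjoints on the codomain subspace\<close>

theorem theorem3p2:
  fixes scale1 :: "'k::real_or_complex \<Rightarrow> 'a::banach \<Rightarrow> 'a" and ip1 :: "'a \<Rightarrow> 'a \<Rightarrow> 'k"
    and scale2 :: "'k \<Rightarrow> 'b::banach \<Rightarrow> 'b" and ip2 :: "'b \<Rightarrow> 'b \<Rightarrow> 'k"
    and M M' :: "'a set" and N N' :: "'b set"
    and T A B C D S TS :: "'a \<Rightarrow> 'b" and X :: "'a \<Rightarrow> 'a"
    and Aa Ba Sa Ta TSa :: "'b \<Rightarrow> 'a" and Xa :: "'a \<Rightarrow> 'a" and Q :: "'b \<Rightarrow> 'b"
  assumes H1: "hilbert_space scale1 ip1" and H2: "hilbert_space scale2 ip2"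
    and M: "module.subspace scale1 M" "closed M"
    and N: "module.subspace scale2 N" "closed N"
    and M': "M' = orth ip1 M" and N': "N' = orth ip2 N"
    and T: "T \<in> bounded_ops scale1 UNIV scale2 UNIV"
    and A: "A = block ip2 M N T" and B: "B = block ip2 M' N T"
    and C: "C = block ip2 M N' T" and D: "D = block ip2 M' N' T"
    and compl: "complementable ip1 ip2 M N T"
    and X: "X \<in> bounded_ops scale1 M scale1 M'" "C = compose M D X"
    and TS: "TS = schur_complement scale1 ip1 ip2 M N T"
    and S: "S = block ip2 M N TS"
    and Ta: "Ta = adj ip1 UNIV ip2 UNIV T" and TSa: "TSa = adj ip1 UNIV ip2 UNIV TS"
    and Aa: "Aa = adj ip1 M ip2 N A" and Ba: "Ba = adj ip1 M' ip2 N B"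
    and Xa: "Xa = adj ip1 M ip1 M' X" and Sa: "Sa = adj ip1 M ip2 N S"
    and Q: "Q = (\<lambda>x\<in>N. B (Ba x) + A (Xa (Ba x)) + B (X (Aa x)) - B (X (Xa (Ba x))))"
  shows
    "(((\<forall>x\<in>N. norm (Ta x) \<ge> norm (TSa x)) \<longleftrightarrow> op_le ip2 N (\<lambda>x\<in>N. 0) Q) \<and>
      (op_le ip2 N (\<lambda>x\<in>N. 0) Q \<longleftrightarrow>
         op_le ip2 N (\<lambda>x\<in>N. S (Sa x)) (\<lambda>x\<in>N. B (Ba x) + A (Aa x)))) \<and>
     (((\<forall>x\<in>N. norm (Ta x) \<le> norm (TSa x)) \<longleftrightarrow> op_le ip2 N Q (\<lambda>x\<in>N. 0)) \<and>
      (op_le ip2 N Q (\<lambda>x\<in>N. 0) \<longleftrightarrow>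
         op_le ip2 N (\<lambda>x\<in>N. B (Ba x) + A (Aa x)) (\<lambda>x\<in>N. S (Sa x)))) \<and>
     (((\<forall>x\<in>N. norm (Ta x) = norm (TSa x)) \<longleftrightarrow> Q = (\<lambda>x\<in>N. 0)) \<and>
      (Q = (\<lambda>x\<in>N. 0) \<longleftrightarrow> (\<lambda>x\<in>N. B (Ba x) + A (Aa x)) = (\<lambda>x\<in>N. S (Sa x))))"
proof -
  interpret H1: hilbert_space scale1 ip1 by fact
  interpret H2: hilbert_space scale2 ip2 by fact
  interpret P: hilbert_pair scale1 ip1 scale2 ip2 ..
  interpret P1: hilbert_pair scale1 ip1 scale1 ip1 ..
  have M'sub: "H1.subspace M'" "closed M'" by (simp_all add: M' H1.subspace_orth H1.closed_orth)
  have Ab: "A \<in> bounded_ops scale1 M scale2 N" unfolding A by (rule P.block_bounded[OF T M(1) N])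
  have Bb: "B \<in> bounded_ops scale1 M' scale2 N" unfolding B by (rule P.block_bounded[OF T M'sub(1) N])
  have A_in: "A u \<in> N" if "u \<in> M" for u using bounded_ops_closed[OF Ab that] .
  have B_in: "B v \<in> N" if "v \<in> M'" for v using bounded_ops_closed[OF Bb that] .
  have X_in: "X u \<in> M'" if "u \<in> M" for u using bounded_ops_closed[OF X(1) that] .
  have Aa_in: "Aa y \<in> M" if "y \<in> N" for y unfolding Aa by (rule P.adj_in[OF Ab M that])
  have Ba_in: "Ba y \<in> M'" if "y \<in> N" for y unfolding Ba by (rule P.adj_in[OF Bb M'sub that])
  have Xa_in: "Xa v \<in> M" if "v \<in> M'" for v unfolding Xa by (rule P1.adj_in[OF X(1) M that])
  have TS_eq: "TS x = A (proj ip1 M x) - B (X (proj ip1 M x))" for x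
    unfolding TS A B
    by (rule P.schur_complement_eq[OF M N M' N' T compl X(1)]) (use X(2) in \<open>simp add: C D\<close>)
  have S_eq: "S u = A u - B (X u)" if u: "u \<in> M" for u
    using u A_in B_in X_in H2.subspace_diff[OF N(1)]
    by (simp add: S block_def TS_eq H1.proj_ident[OF M(1)] H2.proj_ident[OF N(1)])
  \<comment> \<open>\<open>s\<close> is the candidate for the adjoint of \<open>S = A - B X\<close>, and on \<open>N\<close> also for that of \<open>TS\<close>.\<close>
  define s where "s y = Aa y - Xa (Ba y)" for y
  have s_in: "s y \<in> M" if "y \<in> N" for y
    unfolding s_def using that Aa_in Ba_in Xa_in H1.subspace_diff[OF M(1)] by blast
  have ip_S: "ip2 (S u) y = ip1 u (s y)" if u: "u \<in> M" and y: "y \<in> N" for u y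
  proof -
    have "ip2 (S u) y = ip2 (A u) y - ip2 (B (X u)) y" by (simp add: S_eq[OF u] H2.ip_diff_left)
    also have "\<dots> = ip1 u (Aa y) - ip1 (X u) (Ba y)"
      unfolding Aa Ba using P.ip_adj[OF Ab M y u] P.ip_adj[OF Bb M'sub y X_in[OF u]] by simp
    also have "ip1 (X u) (Ba y) = ip1 u (Xa (Ba y))"
      unfolding Xa using P1.ip_adj[OF X(1) M Ba_in[OF y] u] .
    finally show ?thesis by (simp add: s_def H1.ip_diff_right)
  qed
  have Sa_eq: "Sa y = s y" if y: "y \<in> N" for y
    unfolding Sa using M(1) y s_in[OF y] ip_S[OF _ y] by (rule P.adj_eqI)
  have TSa_eq: "TSa y = s y" if y: "y \<in> N" for y
    unfolding TSa
  proof (rule P.adj_eqI[OF H1.subspace_UNIV])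
    fix x
    have "ip2 (TS x) y = ip2 (S (proj ip1 M x)) y"
      using S_eq[OF H1.proj_in[OF M]] by (simp add: TS_eq)
    also have "\<dots> = ip1 x (s y)"
      using ip_S[OF H1.proj_in[OF M] y] H1.ip_proj_left[OF M s_in[OF y]] by simp
    finally show "ip2 (TS x) y = ip1 x (s y)" .
  qed auto
  have Q_eq: "Q y = B (Ba y) + A (Aa y) - S (Sa y)" if y: "y \<in> N" for y
  proof -
    note in_M = Aa_in[OF y] Xa_in[OF Ba_in[OF y]]
    have "S (Sa y) = (A (Aa y) - A (Xa (Ba y))) - (B (X (Aa y)) - B (X (Xa (Ba y))))"
      unfolding Sa_eq[OF y] S_eq[OF s_in[OF y]] unfolding s_def
      by (simp add: H1.bounded_ops_diff[OF Ab M(1) in_M] H1.bounded_ops_diff[OF X(1) M(1) in_M]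
          H1.bounded_ops_diff[OF Bb M'sub(1) X_in[OF in_M(1)] X_in[OF in_M(2)]])
    then show ?thesis using y by (simp add: Q)
  qed
  have Q_in: "Q y \<in> N" if y: "y \<in> N" for y
    using y H2.subspace_add[OF N(1)] H2.subspace_diff[OF N(1)] A_in B_in X_in Aa_in Ba_in Xa_in
    by (simp add: Q)
  \<comment> \<open>A sesquilinear form whose symmetry is visible and whose diagonal compares the two norms.\<close>
  have ip_Q: "ip2 (Q x) y = ip1 (Ba x) (Ba y) + ip1 (Aa x) (Aa y) - ip1 (s x) (s y)"
    if x: "x \<in> N" and y: "y \<in> N" for x y
    unfolding Q_eq[OF x] Sa_eq[OF x] H2.ip_add_left H2.ip_diff_left ip_S[OF s_in[OF x] y]
    using P.ip_adj_adj[OF Ab M x y] P.ip_adj_adj[OF Bb M'sub x y] by (simp flip: Aa Ba)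
  have sym: "ip2 (Q x) y = ip2 x (Q y)" if x: "x \<in> N" and y: "y \<in> N" for x y
  proof -
    have "ip2 x (Q y) = cj (ip2 (Q y) x)" by (simp add: H2.ip_cj)
    also have "\<dots> = cj (ip1 (Ba y) (Ba x) + ip1 (Aa y) (Aa x) + - ip1 (s y) (s x))"
      by (simp add: ip_Q[OF y x])
    also have "\<dots> = ip2 (Q x) y"
      unfolding cj_add cj_minus H1.ip_cj by (simp add: ip_Q[OF x y])
    finally show ?thesis by simp
  qed
  have form: "ip2 (Q x) x = of_real ((norm (Ta x))\<^sup>2 - (norm (TSa x))\<^sup>2)" if x: "x \<in> N" for x
    using P.norm_sq_adj_eq_blocks[OF T M N x]
    by (simp add: ip_Q[OF x x] H1.ip_self TSa_eq[OF x] Ta Aa Ba A B M')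
  have form_neg: "ip2 (- Q x) x = of_real ((norm (TSa x))\<^sup>2 - (norm (Ta x))\<^sup>2)" if x: "x \<in> N" for x
    using form[OF x] H2.ip_diff_left[of 0 "Q x" x] by simp
  have Q_ext: "Q \<in> extensional N" by (simp add: Q)
  have Q_zero: "Q = (\<lambda>x\<in>N. 0) \<longleftrightarrow> (\<forall>x\<in>N. Q x = 0)"
    using Q_ext by (auto intro!: extensionalityI[of _ N])
  have ge: "op_le ip2 N (\<lambda>x\<in>N. 0) Q \<longleftrightarrow> (\<forall>x\<in>N. norm (Ta x) \<ge> norm (TSa x))"
    unfolding op_le_def using form by (simp add: power2_le_iff_abs_le del: of_real_diff)
  have ge': "op_le ip2 N (\<lambda>x\<in>N. S (Sa x)) (\<lambda>x\<in>N. B (Ba x) + A (Aa x)) \<longleftrightarrow> op_le ip2 N (\<lambda>x\<in>N. 0) Q"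
    unfolding op_le_def using Q_eq by simp
  have le: "op_le ip2 N Q (\<lambda>x\<in>N. 0) \<longleftrightarrow> (\<forall>x\<in>N. norm (Ta x) \<le> norm (TSa x))"
    unfolding op_le_def using form_neg by (simp add: power2_le_iff_abs_le del: of_real_diff)
  have le': "op_le ip2 N (\<lambda>x\<in>N. B (Ba x) + A (Aa x)) (\<lambda>x\<in>N. S (Sa x)) \<longleftrightarrow> op_le ip2 N Q (\<lambda>x\<in>N. 0)"
    unfolding op_le_def using Q_eq by simp
  have eq: "(\<forall>x\<in>N. norm (Ta x) = norm (TSa x)) \<longleftrightarrow> Q = (\<lambda>x\<in>N. 0)"
  proof
    assume "\<forall>x\<in>N. norm (Ta x) = norm (TSa x)"
    then have "ip2 (Q x) x = 0" if "x \<in> N" for x using form that by simp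
    then show "Q = (\<lambda>x\<in>N. 0)"
      unfolding Q_zero using H2.symmetric_form_zero_imp_zero[OF N(1) Q_in sym] by blast
  next
    assume "Q = (\<lambda>x\<in>N. 0)"
    then have "of_real ((norm (Ta x))\<^sup>2 - (norm (TSa x))\<^sup>2) = (of_real 0 :: 'k)" if "x \<in> N" for x
      using that form[OF that] by simp
    then show "\<forall>x\<in>N. norm (Ta x) = norm (TSa x)" unfolding of_real_eq_iff by simp
  qed
  have eq': "(\<lambda>x\<in>N. B (Ba x) + A (Aa x)) = (\<lambda>x\<in>N. S (Sa x)) \<longleftrightarrow> Q = (\<lambda>x\<in>N. 0)"
  proof -
    have "(\<lambda>x\<in>N. B (Ba x) + A (Aa x)) = (\<lambda>x\<in>N. S (Sa x)) \<longleftrightarrow> (\<forall>x\<in>N. B (Ba x) + A (Aa x) = S (Sa x))"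
      by (auto simp: fun_eq_iff restrict_def)
    also have "\<dots> \<longleftrightarrow> (\<forall>x\<in>N. Q x = 0)" using Q_eq by auto
    finally show ?thesis unfolding Q_zero .
  qed
  show ?thesis unfolding ge ge' le le' eq eq' by simp
qed

end
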